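(* Let $A_1$ be the property that there exists a node of $T$ on an even level with exactly one child, and let $A_2$ be the property that there exists a node of $T$ on a prime level (a level whose number is a prime) with exactly two children. Then $A_1$ and $A_1 \cup A_2$ are both rapidly determined on $(0,\infty)$.
   Context: $\mathbb{N} = \{0,1,2,\dots\}$. For $\lambda \in (0,\infty)$, $\mathbb{P}_\lambda$ denotes the law under which $\widetilde{X} = (X_1, X_2, \dots)$ (the seed) is a sequence of i.i.d. Poisson($\lambda$) random variables. The seed determines a rooted ordered tree $T$ (the Poisson Galton–Watson tree) with nodes labelled in breadth first order (top to bottom, left to right, the root being node $1$): node $i$, if it exists, has $X_i$ children. If $T$ has a finite number $n$ of vertices, the values $X_j$, $j>n$, are irrelevant to $T$. The level of a node is its distance from the root (the root is on level $0$, which is even). A property $A$ of $T$ is identified with the event $\{T \text{ has property } A\}$, viewed as an event on the seed. For $k\ge 1$ let $\widetilde{X}^{(k)} = (X_1,\dots,X_k)$. An event $A$ is called $k$-tautologically determined if there exists a set $B \subseteq \mathbb{N}^k$ such that $A = \{\widetilde{X}^{(k)} \in B\}$. An event $A$ is called rapidly determined over an interval $I=(\lambda_0,\lambda_1)$, where $0\le\lambda_0<\lambda_1\le\infty$, if there is a sequence of events $(D_k)_{k\ge1}$ (not depending on $\lambda$), with $D_k$ being $k$-tautologically determined, such that for every $\lambda \in I$ there exist constants $c, C > 0$ and $k_0 \in \mathbb{N}$ (which may depend on $\lambda$) with $\mathbb{P}_\lambda(A \triangle D_k) \le C e^{-ck}$ for all $k \ge k_0$. *)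

theory Defs
  imports "HOL-Probability.Probability" "HOL-Computational_Algebra.Primes"
begin

text \<open>
  A seed \<open>(X\<^sub>1, X\<^sub>2, \<dots>)\<close> is a function \<open>x :: nat \<Rightarrow> nat\<close> that is extensional on \<open>{1..}\<close>;
  the value \<open>x 0\<close> carries no information.
\<close>

definition seed_space :: "(nat \<Rightarrow> nat) measure" where
  "seed_space = PiM {1..} (\<lambda>_. count_space UNIV)"

definition seed_law :: "real \<Rightarrow> (nat \<Rightarrow> nat) measure" where
  "seed_law lam = PiM {1..} (\<lambda>_. measure_pmf (poisson_pmf lam))"

text \<open>
  In breadth first order, the children of nodes \<open>1, \<dots>, i - 1\<close> receive the labels
  \<open>2, \<dots>, 1 + (x 1 + \<dots> + x (i - 1))\<close>, and the children of node \<open>i\<close> receive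
  the next \<open>x i\<close> labels. Labels that are not nodes of the tree also get an interval here;
  only what is reachable from the root \<open>1\<close> belongs to the tree.
\<close>

definition children :: "(nat \<Rightarrow> nat) \<Rightarrow> nat \<Rightarrow> nat set" where
  "children x i = {2 + (\<Sum>j\<in>{1..<i}. x j) .. 1 + (\<Sum>j\<in>{1..i}. x j)}"

definition child_rel :: "(nat \<Rightarrow> nat) \<Rightarrow> (nat \<times> nat) set" where
  "child_rel x = {(i, j). j \<in> children x i}"

definition nodes :: "(nat \<Rightarrow> nat) \<Rightarrow> nat set" where
  "nodes x = (child_rel x)\<^sup>* `` {1}"

text \<open>The distance from the root; meaningful for \<open>i \<in> nodes x\<close> only.\<close>

definition level :: "(nat \<Rightarrow> nat) \<Rightarrow> nat \<Rightarrow> nat" where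
  "level x i = (LEAST d. (1, i) \<in> child_rel x ^^ d)"

definition taut_determined :: "nat \<Rightarrow> (nat \<Rightarrow> nat) set \<Rightarrow> bool" where
  "taut_determined k A \<longleftrightarrow>
     (\<exists>B. B \<subseteq> ({1..k} \<rightarrow>\<^sub>E UNIV) \<and> A = {x \<in> space seed_space. restrict x {1..k} \<in> B})"

text \<open>
  Measurability of \<open>A\<close> is demanded explicitly, because \<open>measure\<close> is \<open>0\<close> on
  non-measurable sets; that of \<open>D k\<close> follows from \<open>taut_determined\<close>. The set \<open>I\<close> is meant
  to be an open interval of positive reals.
\<close>

definition rapidly_determined :: "(nat \<Rightarrow> nat) set \<Rightarrow> real set \<Rightarrow> bool" where
  "rapidly_determined A I \<longleftrightarrow>
     A \<in> sets seed_space \<and>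
     (\<exists>D. (\<forall>k\<ge>1. taut_determined k (D k)) \<and>
          (\<forall>lam\<in>I. \<exists>c>0. \<exists>C>0. \<exists>k0::nat. \<forall>k\<ge>1. k \<ge> k0 \<longrightarrow>
             measure (seed_law lam) (sym_diff A (D k)) \<le> C * exp (- c * real k)))"

definition A1 :: "(nat \<Rightarrow> nat) set" where
  "A1 = {x \<in> space seed_space.
           \<exists>i\<in>nodes x. even (level x i) \<and> card (children x i) = 1}"

definition A2 :: "(nat \<Rightarrow> nat) set" where
  "A2 = {x \<in> space seed_space.
           \<exists>i\<in>nodes x. prime (level x i) \<and> card (children x i) = 2}"

end

theory Submission
  imports Defs
begin

text \<open>
  A witness among the first \<open>k\<close> nodes can be read off the first \<open>k\<close> values, so the determination
  can only go wrong when node \<open>k\<close> exists and none of the first \<open>k\<close> nodes on an even level has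
  exactly one child. In that case each of these nodes is on an even level or is a child of one of
  them, whence \<open>k \<le> \<Sum> (x i + 1)\<close>, the sum being over the nodes \<open>i \<le> k\<close> on even levels. For
  small \<open>t > 0\<close> the expectation of \<open>exp (t * (X + 1))\<close> over \<open>X \<noteq> 1\<close> is at most \<open>1\<close>, because at
  \<open>t = 0\<close> it is \<open>1 - P (X = 1) < 1\<close>. As it depends on the earlier values only whether node \<open>i\<close>
  exists and is on an even level, the product of \<open>exp (t * (x i + 1))\<close>, replaced by \<open>0\<close> if
  \<open>x i = 1\<close>, over these nodes is a supermartingale in \<open>k\<close>, and Markov's inequality bounds the
  error probability by \<open>exp (- t * k)\<close>.
\<close>

section \<open>Breadth first labels\<close>

lemma card_children: "1 \<le> i \<Longrightarrow> card (children x i) = x i"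
proof -
  assume "1 \<le> i"
  then have "{1..i} = insert i {1..<i}" by auto
  then show ?thesis by (simp add: children_def)
qed

lemma finite_children: "finite (children x i)"
  by (simp add: children_def)

lemma sum_upto_mono: "i \<le> j \<Longrightarrow> (\<Sum>l\<in>{1..i}. x l) \<le> (\<Sum>l\<in>{1..j}. x l)" for x :: "nat \<Rightarrow> nat"
  by (rule sum_mono2) auto

lemma children_cong:
  assumes "\<And>l. 1 \<le> l \<Longrightarrow> l \<le> i \<Longrightarrow> x l = y l"
  shows "children x i = children y i"
proof -
  have "(\<Sum>l\<in>{1..<i}. x l) = (\<Sum>l\<in>{1..<i}. y l)" "(\<Sum>l\<in>{1..i}. x l) = (\<Sum>l\<in>{1..i}. y l)"
    by (rule sum.cong; use assms in auto)+
  then show ?thesis by (simp add: children_def)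
qed

text \<open>If \<open>i\<close> is a child of \<open>p\<close>, the labels up to \<open>p\<close>
  have at least \<open>i - 1\<close> children in total, which settles \<open>j \<ge> p\<close>; the
  induction hypothesis at \<open>p\<close> settles \<open>j < p\<close>.\<close>

lemma relpow_child_rel_sum:
  assumes "(1, i) \<in> child_rel x ^^ d"
  shows "1 \<le> i \<and> (\<forall>j<i. j \<le> (\<Sum>l\<in>{1..j}. x l))"
  using assms
proof (induction d arbitrary: i)
  case 0
  then show ?case by simp
next
  case (Suc d)
  then obtain p where p: "(1, p) \<in> child_rel x ^^ d" and c: "i \<in> children x p"
    by (auto simp: child_rel_def)
  have "j \<le> (\<Sum>l\<in>{1..j}. x l)" if "j < i" for j
  proof (cases "j < p")
    case True
    then show ?thesis using Suc.IH[OF p] by blast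
  next
    case False
    then show ?thesis using sum_upto_mono[of p j x] c that by (auto simp: children_def)
  qed
  then show ?case using c by (auto simp: children_def)
qed

text \<open>The child labels of \<open>p\<close> start at
  \<open>2 + (x 1 + ... + x (p - 1))\<close>, which is at least \<open>p + 1\<close> once
  \<open>p\<close> is reachable. An unreachable label can even be its own child.\<close>

lemma parent_less:
  assumes "(1, p) \<in> child_rel x ^^ d" "i \<in> children x p"
  shows "1 \<le> p" "p < i"
proof -
  note * = relpow_child_rel_sum[OF assms(1)]
  show "1 \<le> p" using * by blast
  then have "{1..<p} = {1..p - 1}" "p - 1 < p" by auto
  then show "p < i" using * assms(2) by (fastforce simp: children_def)
qed

lemma parent_unique:
  assumes "i \<in> children x p" "i \<in> children x q"
  shows "p = q"
proof (rule ccontr)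
  assume "p \<noteq> q"
  have False if "i \<in> children x p" "i \<in> children x q" "p < q" for p q
  proof -
    have "(\<Sum>l\<in>{1..p}. x l) \<le> (\<Sum>l\<in>{1..<q}. x l)"
      using that(3) by (intro sum_mono2) auto
    then show False using that by (auto simp: children_def)
  qed
  then show False using assms \<open>p \<noteq> q\<close> by (meson linorder_neqE_nat)
qed

text \<open>Parents are unique and the root has none, since child labels start at 2; so two paths
  agree when peeled off from their common end. Hence the \<open>LEAST\<close> in
  \<open>level\<close> is the length of any path.\<close>

lemma relpow_child_rel_unique:
  assumes "(1, i) \<in> child_rel x ^^ d" "(1, i) \<in> child_rel x ^^ e"
  shows "d = e"
  using assms
proof (induction d arbitrary: i e)
  case 0
  then show ?case
    by (cases e) (auto simp: child_rel_def children_def)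
next
  case (Suc d)
  obtain p where p: "(1, p) \<in> child_rel x ^^ d" "i \<in> children x p"
    using Suc.prems(1) by (auto simp: child_rel_def)
  show ?case
  proof (cases e)
    case 0
    then show ?thesis using Suc.prems p by (auto simp: children_def)
  next
    case (Suc e')
    then obtain q where q: "(1, q) \<in> child_rel x ^^ e'" "i \<in> children x q"
      using Suc.prems(2) by (auto simp: child_rel_def)
    then show ?thesis using Suc.IH p parent_unique Suc by metis
  qed
qed

lemma nodes_iff_relpow: "i \<in> nodes x \<longleftrightarrow> (\<exists>d. (1, i) \<in> child_rel x ^^ d)"
  by (simp add: nodes_def rtrancl_power)

lemma level_eq: "(1, i) \<in> child_rel x ^^ d \<Longrightarrow> level x i = d"
  unfolding level_def by (rule Least_equality) (use relpow_child_rel_unique in blast)+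

text \<open>Breadth first exploration stops at the first \<open>j\<close> such that the labels up to
  \<open>j\<close> have fewer than \<open>j\<close> children in total. In this form it is evident
  that the nodes are an initial segment of the labels.\<close>

lemma nodes_iff_sum: "i \<in> nodes x \<longleftrightarrow> 1 \<le> i \<and> (\<forall>j<i. j \<le> (\<Sum>l\<in>{1..j}. x l))"
proof
  assume "i \<in> nodes x"
  then show "1 \<le> i \<and> (\<forall>j<i. j \<le> (\<Sum>l\<in>{1..j}. x l))"
    by (auto simp only: nodes_iff_relpow dest: relpow_child_rel_sum)
next
  assume "1 \<le> i \<and> (\<forall>j<i. j \<le> (\<Sum>l\<in>{1..j}. x l))"
  then show "i \<in> nodes x"
  proof (induction i rule: less_induct)
    case (less i)
    show ?case
    proof (cases "i = 1")
      case True
      then show ?thesis by (simp add: nodes_def)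
    next
      case False
      \<comment> \<open>The parent is the first label whose child interval reaches up to
        \<open>i\<close>; minimality yields the lower end of the interval.\<close>
      define p where "p = (LEAST p. i \<le> 1 + (\<Sum>l\<in>{1..p}. x l))"
      have *: "i \<le> 1 + (\<Sum>l\<in>{1..i - 1}. x l)"
      proof -
        have "i - 1 < i" using less.prems by simp
        then have "i - 1 \<le> (\<Sum>l\<in>{1..i - 1}. x l)" using less.prems by blast
        then show ?thesis by linarith
      qed
      have p1: "i \<le> 1 + (\<Sum>l\<in>{1..p}. x l)"
        unfolding p_def using * by (rule LeastI)
      have p2: "p \<le> i - 1"
        unfolding p_def using * by (rule Least_le)
      have p3: "1 \<le> p" using p1 False less.prems by (cases p) auto
      have "\<not> i \<le> 1 + (\<Sum>l\<in>{1..p - 1}. x l)"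
        using p3 not_less_Least[of "p - 1" "\<lambda>p. i \<le> 1 + (\<Sum>l\<in>{1..p}. x l)"]
        unfolding p_def[symmetric] by simp
      moreover have "{1..p - 1} = {1..<p}" using p3 by auto
      ultimately have c: "i \<in> children x p" using p1 by (auto simp: children_def)
      have "p \<in> nodes x" using less p2 p3 by auto
      then show ?thesis
        using c unfolding nodes_def child_rel_def
        by (auto intro: rtrancl_into_rtrancl)
    qed
  qed
qed

lemma nodes_ge_1: "i \<in> nodes x \<Longrightarrow> 1 \<le> i"
  by (simp add: nodes_iff_sum)

lemma nodes_downward: "i \<in> nodes x \<Longrightarrow> 1 \<le> j \<Longrightarrow> j \<le> i \<Longrightarrow> j \<in> nodes x"
  by (auto simp: nodes_iff_sum)

lemma odd_level_parent:
  assumes "i \<in> nodes x" "odd (level x i)"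
  obtains p where "p \<in> nodes x" "even (level x p)" "i \<in> children x p" "p < i"
proof -
  obtain d where d: "(1, i) \<in> child_rel x ^^ d" using assms by (auto simp: nodes_iff_relpow)
  with assms have "odd d" by (simp add: level_eq)
  then obtain d' where d': "d = Suc d'" "even d'" by (cases d) auto
  with d obtain p where p: "(1, p) \<in> child_rel x ^^ d'" "i \<in> children x p"
    by (auto simp: child_rel_def)
  then show thesis
    using that[of p] parent_less[OF p] d' by (auto simp: nodes_iff_relpow level_eq)
qed

text \<open>Ancestors have smaller labels, and being a child of \<open>p\<close> depends only on the
  values up to \<open>p\<close>. The strict bound \<open>l < i\<close> matters: existence and level
  of node \<open>i\<close> do not involve \<open>x i\<close>.\<close>

lemma relpow_child_rel_cong:
  assumes "\<And>l. 1 \<le> l \<Longrightarrow> l < i \<Longrightarrow> x l = y l"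
  shows "(1, i) \<in> child_rel x ^^ d \<longleftrightarrow> (1, i) \<in> child_rel y ^^ d"
proof -
  have "(1, i) \<in> child_rel y ^^ d"
    if "(1, i) \<in> child_rel x ^^ d" "\<And>l. 1 \<le> l \<Longrightarrow> l < i \<Longrightarrow> x l = y l" for x y i
    using that
  proof (induction d arbitrary: i)
    case 0
    then show ?case by simp
  next
    case (Suc d)
    obtain p where p: "(1, p) \<in> child_rel x ^^ d" "i \<in> children x p"
      using Suc.prems(1) by (auto simp: child_rel_def)
    note pi = parent_less[OF p]
    have "(1, p) \<in> child_rel y ^^ d" using Suc.IH[OF p(1)] Suc.prems(2) pi by auto
    moreover have "i \<in> children y p"
      using p(2) children_cong[of p x y] Suc.prems(2) pi by auto
    ultimately show ?case by (auto simp: child_rel_def)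
  qed
  from this[of i x y] this[of i y x] assms show ?thesis by metis
qed

lemma nodes_cong:
  assumes "\<And>l. 1 \<le> l \<Longrightarrow> l < i \<Longrightarrow> x l = y l"
  shows "i \<in> nodes x \<longleftrightarrow> i \<in> nodes y"
  using relpow_child_rel_cong[OF assms] by (simp add: nodes_iff_relpow)

lemma level_cong:
  assumes "\<And>l. 1 \<le> l \<Longrightarrow> l < i \<Longrightarrow> x l = y l"
  shows "level x i = level y i"
  using relpow_child_rel_cong[OF assms] by (simp add: level_def)

definition even_nodes :: "(nat \<Rightarrow> nat) \<Rightarrow> nat set" where
  "even_nodes x = {i \<in> nodes x. even (level x i)}"

lemma even_nodes_cong:
  assumes "\<And>l. 1 \<le> l \<Longrightarrow> l < i \<Longrightarrow> x l = y l"
  shows "i \<in> even_nodes x \<longleftrightarrow> i \<in> even_nodes y"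
  using nodes_cong[OF assms] level_cong[OF assms] by (simp add: even_nodes_def)

text \<open>A node on an odd level is charged to its parent, whose smaller label also lies in
  \<open>{1..k}\<close>; each node on an even level pays for itself and its \<open>x i\<close>
  children.\<close>

lemma le_sum_even_nodes:
  assumes "k \<in> nodes x"
  shows "k \<le> (\<Sum>i\<in>{1..k} \<inter> even_nodes x. x i + 1)"
proof -
  let ?E = "{1..k} \<inter> even_nodes x"
  have "{1..k} \<subseteq> ?E \<union> (\<Union>i\<in>?E. children x i)"
  proof
    fix j assume j: "j \<in> {1..k}"
    then have n: "j \<in> nodes x" using nodes_downward[OF assms] by auto
    show "j \<in> ?E \<union> (\<Union>i\<in>?E. children x i)"
    proof (cases "even (level x j)")
      case True
      then show ?thesis using j n by (simp add: even_nodes_def)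
    next
      case False
      obtain p where "p \<in> nodes x" "even (level x p)" "j \<in> children x p" "p < j"
        using odd_level_parent[OF n False] .
      moreover from this have "p \<in> ?E"
        using j nodes_ge_1 by (auto simp: even_nodes_def)
      ultimately show ?thesis by blast
    qed
  qed
  then have "card {1..k} \<le> card (?E \<union> (\<Union>i\<in>?E. children x i))"
    by (intro card_mono) (auto intro: finite_children)
  also have "\<dots> \<le> card ?E + card (\<Union>i\<in>?E. children x i)" by (rule card_Un_le)
  also have "\<dots> \<le> card ?E + (\<Sum>i\<in>?E. card (children x i))"
    by (intro add_left_mono card_UN_le) auto
  also have "\<dots> = card ?E + (\<Sum>i\<in>?E. x i)"
    by (intro arg_cong2[where f = "(+)"] refl sum.cong) (simp_all add: card_children)
  also have "\<dots> = (\<Sum>i\<in>?E. x i + 1)"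
    by (simp only: sum.distrib card_eq_sum add.commute)
  finally show ?thesis by simp
qed

section \<open>Measurability\<close>

lemma space_seed_space: "space seed_space = {1..} \<rightarrow>\<^sub>E UNIV"
  by (simp add: seed_space_def space_PiM)

lemma sets_seed_law: "sets (seed_law lam) = sets seed_space"
  unfolding seed_law_def seed_space_def by (intro sets_PiM_cong) simp_all

lemma prob_space_seed_law: "prob_space (seed_law lam)"
  unfolding seed_law_def by (intro prob_space_PiM measure_pmf.prob_space_axioms)

text \<open>Finitely many countable discrete factors give a discrete product, so functions of the
  tree need no separate measurability argument there.\<close>

lemma sets_PiM_pmf_finite:
  fixes p :: "'a::countable pmf"
  assumes "finite J"
  shows "sets (PiM J (\<lambda>_. measure_pmf p)) = Pow (J \<rightarrow>\<^sub>E UNIV)"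
proof -
  have "sets (PiM J (\<lambda>_. measure_pmf p)) = sets (PiM J (\<lambda>_. count_space (UNIV::'a set)))"
    by (intro sets_PiM_cong) simp_all
  then show ?thesis using assms by (simp add: count_space_PiM_finite)
qed

lemma taut_determined_sets:
  assumes "taut_determined k A"
  shows "A \<in> sets seed_space"
proof -
  obtain B where B: "B \<subseteq> {1..k} \<rightarrow>\<^sub>E UNIV" "A = {x \<in> space seed_space. restrict x {1..k} \<in> B}"
    using assms by (auto simp: taut_determined_def)
  let ?N = "PiM {1..k} (\<lambda>_. count_space (UNIV :: nat set))"
  have "(\<lambda>x. restrict x {1..k}) \<in> measurable seed_space ?N"
    unfolding seed_space_def by (rule measurable_restrict_subset) auto
  moreover have "B \<in> sets ?N" using B by (simp add: count_space_PiM_finite)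
  ultimately have "(\<lambda>x. restrict x {1..k}) -` B \<inter> space seed_space \<in> sets seed_space"
    by (rule measurable_sets)
  moreover have "(\<lambda>x. restrict x {1..k}) -` B \<inter> space seed_space = A" using B by auto
  ultimately show ?thesis by simp
qed

text \<open>Such a \<open>P\<close> cannot tell \<open>x\<close> from its restriction, so
  \<open>P\<close> itself, read on the extensional functions, cuts out the required
  \<open>B\<close>.\<close>

lemma taut_determinedI:
  assumes "\<And>x y. (\<And>l. 1 \<le> l \<Longrightarrow> l \<le> k \<Longrightarrow> x l = y l) \<Longrightarrow> P x \<longleftrightarrow> P y"
  shows "taut_determined k {x \<in> space seed_space. P x}"
proof -
  have "P (restrict x {1..k}) \<longleftrightarrow> P x" for x by (rule assms) auto
  then show ?thesis
    unfolding taut_determined_def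
    by (intro exI[of _ "{x \<in> {1..k} \<rightarrow>\<^sub>E UNIV. P x}"]) auto
qed

text \<open>Moves probabilities to the finite marginal, where coordinates can be integrated out one
  at a time.\<close>

lemma emeasure_seed_law_restrict:
  assumes "\<And>x y. (\<And>l. 1 \<le> l \<Longrightarrow> l \<le> k \<Longrightarrow> x l = y l) \<Longrightarrow> P x \<longleftrightarrow> P y"
  shows "emeasure (seed_law lam) {x \<in> space seed_space. P x} =
    emeasure (PiM {1..k} (\<lambda>_. measure_pmf (poisson_pmf lam))) {x \<in> {1..k} \<rightarrow>\<^sub>E UNIV. P x}"
proof -
  let ?p = "measure_pmf (poisson_pmf lam)"
  let ?N = "PiM {1..k} (\<lambda>_. ?p)"
  let ?B = "{x \<in> {1..k} \<rightarrow>\<^sub>E UNIV. P x}"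
  interpret product_prob_space "\<lambda>_. ?p" "{1::nat..}"
    by unfold_locales
  have N: "distr (seed_law lam) ?N (\<lambda>x. restrict x {1..k}) = ?N"
    unfolding seed_law_def by (rule distr_PiM_restrict_finite) auto
  have m: "(\<lambda>x. restrict x {1..k}) \<in> measurable (seed_law lam) ?N"
    unfolding seed_law_def by (rule measurable_restrict_subset) auto
  have P: "P (restrict x {1..k}) \<longleftrightarrow> P x" for x by (rule assms) auto
  have sp: "space (seed_law lam) = space seed_space"
    by (rule sets_eq_imp_space_eq[OF sets_seed_law])
  have "?B \<in> sets ?N" by (subst sets_PiM_pmf_finite) auto
  then have "emeasure ?N ?B = emeasure (seed_law lam)
      ((\<lambda>x. restrict x {1..k}) -` ?B \<inter> space (seed_law lam))"
    by (subst N[symmetric]) (rule emeasure_distr[OF m])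
  also have "(\<lambda>x. restrict x {1..k}) -` ?B \<inter> space (seed_law lam) = {x \<in> space seed_space. P x}"
    using P by (auto simp: sp)
  finally show ?thesis by simp
qed

section \<open>The exponential supermartingale\<close>

text \<open>The exponent counts a node together with its children; the zero makes a product vanish
  once some factor belongs to a node with one child.\<close>

definition no_one_weight :: "real \<Rightarrow> nat \<Rightarrow> ennreal" where
  "no_one_weight t n = (if n = 1 then 0 else ennreal (exp (t * (real n + 1))))"

definition even_weight :: "real \<Rightarrow> nat \<Rightarrow> (nat \<Rightarrow> nat) \<Rightarrow> ennreal" where
  "even_weight t k x = (\<Prod>i\<in>{1..k} \<inter> even_nodes x. no_one_weight t (x i))"

text \<open>The exponential series at \<open>lam * exp t\<close> gives the full expectation of
  \<open>exp (t * (X + 1))\<close>; the subtracted term is the contribution of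
  \<open>n = 1\<close>.\<close>

lemma nn_integral_no_one_weight:
  assumes "0 < lam"
  shows "(\<integral>\<^sup>+n. no_one_weight t n \<partial>measure_pmf (poisson_pmf lam)) =
    ennreal (exp (t + lam * (exp t - 1)) - lam * exp (2 * t - lam))"
proof -
  let ?f = "\<lambda>n. exp (t - lam) * ((lam * exp t) ^ n /\<^sub>R fact n)"
  let ?g = "\<lambda>n. if n = (1::nat) then 0 else ?f n"
  have s1: "?f sums (exp (t - lam) * exp (lam * exp t))"
    by (intro sums_mult exp_converges)
  have s2: "(\<lambda>n. if n = 1 then ?f n else 0) sums ?f 1"
    by (rule sums_single)
  have "(\<lambda>n. ?f n - (if n = 1 then ?f n else 0)) sums
      (exp (t - lam) * exp (lam * exp t) - ?f 1)"
    by (rule sums_diff[OF s1 s2])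
  moreover have "(\<lambda>n. ?f n - (if n = 1 then ?f n else 0)) = ?g" by auto
  moreover have "exp (t - lam) * exp (lam * exp t) - ?f 1 =
      exp (t + lam * (exp t - 1)) - lam * exp (2 * t - lam)"
    by (simp add: exp_add[symmetric] algebra_simps exp_diff exp_double power2_eq_square)
  ultimately have s: "?g sums (exp (t + lam * (exp t - 1)) - lam * exp (2 * t - lam))" by simp
  have "(\<integral>\<^sup>+n. no_one_weight t n \<partial>measure_pmf (poisson_pmf lam)) =
      (\<integral>\<^sup>+n. ennreal (pmf (poisson_pmf lam) n) * no_one_weight t n \<partial>count_space UNIV)"
    by (rule nn_integral_measure_pmf)
  also have "\<dots> = (\<integral>\<^sup>+n. ennreal (?g n) \<partial>count_space UNIV)"
  proof (rule nn_integral_cong)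
    fix n :: nat
    have "exp (t * (real n + 1)) = exp t ^ n * exp t"
      by (simp add: algebra_simps exp_add exp_of_nat_mult[symmetric])
    then show "ennreal (pmf (poisson_pmf lam) n) * no_one_weight t n = ennreal (?g n)"
      using assms
      by (auto simp: no_one_weight_def pmf_poisson ennreal_mult[symmetric] exp_diff
          exp_minus field_simps power_mult_distrib)
  qed
  also have "\<dots> = (\<Sum>n. ennreal (?g n))" by (rule nn_integral_count_space_nat)
  also have "\<dots> = ennreal (exp (t + lam * (exp t - 1)) - lam * exp (2 * t - lam))"
    by (rule suminf_ennreal_eq[OF _ s]) (use assms in auto)
  finally show ?thesis .
qed

lemma ex_no_one_weight_le_1:
  assumes "0 < lam"
  shows "\<exists>t>0. (\<integral>\<^sup>+n. no_one_weight t n \<partial>measure_pmf (poisson_pmf lam)) \<le> 1"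
proof -
  let ?h = "\<lambda>t. exp (t + lam * (exp t - 1)) - lam * exp (2 * t - lam)"
  have "(?h \<longlongrightarrow> ?h 0) (at_right 0)" by (intro tendsto_intros)
  \<comment> \<open>\<open>?h 0\<close> is \<open>1 - lam * exp (- lam)\<close>; the strict
    inequality leaves room for some positive \<open>t\<close>.\<close>
  moreover have "?h 0 < 1" using assms by simp
  ultimately have "eventually (\<lambda>t. ?h t < 1) (at_right 0)" by (rule order_tendstoD)
  then obtain b where "0 < b" "\<And>t. 0 < t \<Longrightarrow> t < b \<Longrightarrow> ?h t < 1"
    by (auto simp: eventually_at_right_field)
  then have "0 < b / 2" "?h (b / 2) < 1" by (simp, metis half_gt_zero field_sum_of_halves less_add_same_cancel1)
  then show ?thesis
    using assms by (intro exI[of _ "b / 2"]) (auto simp: nn_integral_no_one_weight)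
qed

lemma even_weight_Suc:
  "even_weight t (Suc k) (x(Suc k := n)) =
    even_weight t k x * (if Suc k \<in> even_nodes x then no_one_weight t n else 1)"
proof -
  let ?y = "x(Suc k := n)"
  \<comment> \<open>This includes \<open>i = Suc k\<close>, so \<open>n\<close> enters through a
    single factor.\<close>
  have e: "i \<in> even_nodes ?y \<longleftrightarrow> i \<in> even_nodes x" if "i \<le> Suc k" for i
    using that by (intro even_nodes_cong) auto
  have w: "(\<Prod>i\<in>{1..k} \<inter> even_nodes x. no_one_weight t (?y i)) = even_weight t k x"
    unfolding even_weight_def by (intro prod.cong) auto
  have "{1..Suc k} \<inter> even_nodes ?y =
    (if Suc k \<in> even_nodes x then insert (Suc k) ({1..k} \<inter> even_nodes x)
     else {1..k} \<inter> even_nodes x)"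
    using e by (auto simp: le_Suc_eq)
  then show ?thesis
    using w by (simp add: even_weight_def[of t "Suc k"] mult.commute)
qed

text \<open>The last coordinate is integrated out first: for fixed earlier values it contributes a
  factor of mean at most 1.\<close>

lemma nn_integral_even_weight_le_1:
  assumes "(\<integral>\<^sup>+n. no_one_weight t n \<partial>measure_pmf p) \<le> 1"
  shows "(\<integral>\<^sup>+x. even_weight t k x \<partial>PiM {1..k} (\<lambda>_. measure_pmf p)) \<le> 1"
proof (induction k)
  case 0
  show ?case by (simp add: even_weight_def PiM_empty nn_integral_count_space_finite)
next
  case (Suc k)
  interpret product_sigma_finite "\<lambda>_::nat. measure_pmf p"
    by unfold_locales
  have ins: "{1..Suc k} = insert (Suc k) {1..k}" by auto
  have meas: "f \<in> borel_measurable (PiM J (\<lambda>_. measure_pmf p))"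
    if "finite J" for f :: "(nat \<Rightarrow> nat) \<Rightarrow> ennreal" and J
    using that by (auto simp: measurable_def sets_PiM_pmf_finite space_PiM)
  have "(\<integral>\<^sup>+x. even_weight t (Suc k) x \<partial>PiM {1..Suc k} (\<lambda>_. measure_pmf p)) =
    (\<integral>\<^sup>+x. (\<integral>\<^sup>+n. even_weight t (Suc k) (x(Suc k := n)) \<partial>measure_pmf p)
      \<partial>PiM {1..k} (\<lambda>_. measure_pmf p))"
    unfolding ins by (rule product_nn_integral_insert) (auto intro: meas)
  also have "\<dots> \<le> (\<integral>\<^sup>+x. even_weight t k x \<partial>PiM {1..k} (\<lambda>_. measure_pmf p))"
  proof (rule nn_integral_mono)
    fix x
    have "(\<integral>\<^sup>+n. (if Suc k \<in> even_nodes x then no_one_weight t n else 1) \<partial>measure_pmf p) \<le> 1"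
      using assms by (cases "Suc k \<in> even_nodes x") simp_all
    then show "(\<integral>\<^sup>+n. even_weight t (Suc k) (x(Suc k := n)) \<partial>measure_pmf p) \<le> even_weight t k x"
      by (simp add: even_weight_Suc nn_integral_cmult mult_left_le)
  qed
  also have "\<dots> \<le> 1" by (rule Suc.IH)
  finally show ?case .
qed

text \<open>No factor is in the zero case, so the product is the exponential of \<open>t\<close>
  times the sum in \<open>le_sum_even_nodes\<close>.\<close>

lemma even_weight_ge:
  assumes "0 \<le> t" "k \<in> nodes x" "\<And>i. i \<in> {1..k} \<inter> even_nodes x \<Longrightarrow> x i \<noteq> 1"
  shows "ennreal (exp (t * real k)) \<le> even_weight t k x"
proof -
  let ?E = "{1..k} \<inter> even_nodes x"
  have "real k \<le> (\<Sum>i\<in>?E. real (x i) + 1)"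
    using of_nat_mono[OF le_sum_even_nodes[OF assms(2)], where 'a = real]
    by (simp only: of_nat_sum of_nat_add of_nat_1)
  then have "exp (t * real k) \<le> exp (\<Sum>i\<in>?E. t * (real (x i) + 1))"
    using assms(1) by (simp add: sum_distrib_left[symmetric] mult_left_mono)
  also have "\<dots> = (\<Prod>i\<in>?E. exp (t * (real (x i) + 1)))" by (simp add: exp_sum)
  finally have "ennreal (exp (t * real k)) \<le> (\<Prod>i\<in>?E. ennreal (exp (t * (real (x i) + 1))))"
    by (simp add: prod_ennreal ennreal_leI)
  also have "\<dots> = even_weight t k x"
    unfolding even_weight_def by (rule prod.cong) (use assms(3) in \<open>auto simp: no_one_weight_def\<close>)
  finally show ?thesis .
qed

text \<open>\<open>t\<close> is chosen before \<open>k\<close>, so that it can serve as the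
  exponential rate for this \<open>lam\<close>.\<close>

lemma even_no_one_child_bound:
  assumes "0 < lam"
  shows "\<exists>t>0. \<forall>k. {x \<in> space seed_space. k \<in> nodes x \<and> (\<forall>i\<in>{1..k} \<inter> even_nodes x. x i \<noteq> 1)}
      \<in> sets seed_space \<and>
    measure (seed_law lam)
      {x \<in> space seed_space. k \<in> nodes x \<and> (\<forall>i\<in>{1..k} \<inter> even_nodes x. x i \<noteq> 1)}
      \<le> exp (- t * real k)"
proof -
  obtain t where t: "0 < t"
    and le1: "(\<integral>\<^sup>+n. no_one_weight t n \<partial>measure_pmf (poisson_pmf lam)) \<le> 1"
    using ex_no_one_weight_le_1[OF assms] by blast
  interpret L: prob_space "seed_law lam" by (rule prob_space_seed_law)
  show ?thesis
  proof (intro exI[of _ t] conjI t allI)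
    fix k
    let ?P = "\<lambda>x. k \<in> nodes x \<and> (\<forall>i\<in>{1..k} \<inter> even_nodes x. x i \<noteq> 1)"
    let ?F = "{x \<in> space seed_space. ?P x}"
    let ?G = "{x \<in> {1..k} \<rightarrow>\<^sub>E UNIV. ?P x}"
    let ?N = "PiM {1..k} (\<lambda>_::nat. measure_pmf (poisson_pmf lam))"
    have cong: "?P x \<longleftrightarrow> ?P y" if eq: "\<And>l. 1 \<le> l \<Longrightarrow> l \<le> k \<Longrightarrow> x l = y l" for x y
    proof -
      have "k \<in> nodes x \<longleftrightarrow> k \<in> nodes y" using eq by (intro nodes_cong) auto
      moreover have "i \<in> even_nodes x \<longleftrightarrow> i \<in> even_nodes y" if "i \<in> {1..k}" for i
        using eq that by (intro even_nodes_cong) auto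
      ultimately show ?thesis using eq by auto
    qed
    show "?F \<in> sets seed_space"
      by (rule taut_determined_sets, rule taut_determinedI) (rule cong)
    have G: "?G \<in> sets ?N" by (subst sets_PiM_pmf_finite) auto
    \<comment> \<open>Markov's inequality, carried out on the finite marginal.\<close>
    have "ennreal (exp (t * real k)) * emeasure ?N ?G =
        (\<integral>\<^sup>+x. ennreal (exp (t * real k)) * indicator ?G x \<partial>?N)"
      using G by (simp add: nn_integral_cmult_indicator)
    also have "\<dots> \<le> (\<integral>\<^sup>+x. even_weight t k x \<partial>?N)"
      using t by (intro nn_integral_mono) (auto simp: indicator_def intro!: even_weight_ge)
    also have "\<dots> \<le> 1" by (rule nn_integral_even_weight_le_1[OF le1])
    finally have "ennreal (exp (t * real k)) * emeasure (seed_law lam) ?F \<le> 1"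
      by (subst emeasure_seed_law_restrict[OF cong])
    then have "exp (t * real k) * measure (seed_law lam) ?F \<le> 1"
      by (simp add: L.emeasure_eq_measure ennreal_mult[symmetric])
    then show "measure (seed_law lam) ?F \<le> exp (- t * real k)"
      by (simp add: exp_minus inverse_eq_divide pos_le_divide_eq mult.commute)
  qed
qed

section \<open>Rapid determination\<close>

text \<open>Treats both events at once: since one child on an even level is always a witness, the
  error event for any such \<open>Q\<close> lies in the one already bounded.\<close>

lemma rapidly_determined_ex_node:
  assumes Q: "\<And>l. even l \<Longrightarrow> Q l 1"
  shows "rapidly_determined
    {x \<in> space seed_space. \<exists>i\<in>nodes x. Q (level x i) (card (children x i))} {0<..}"
proof -
  let ?W = "\<lambda>x i. i \<in> nodes x \<and> Q (level x i) (card (children x i))"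
  let ?A = "{x \<in> space seed_space. \<exists>i\<in>nodes x. Q (level x i) (card (children x i))}"
  \<comment> \<open>These sets are independent of \<open>lam\<close>; admitting \<open>i = 0\<close>
    is harmless, as 0 is never a node.\<close>
  let ?D = "\<lambda>k. {x \<in> space seed_space. \<exists>i\<le>k. ?W x i}"
  have W_cong: "?W x i \<longleftrightarrow> ?W y i" if "\<And>l. 1 \<le> l \<Longrightarrow> l \<le> i \<Longrightarrow> x l = y l" for x y i
    using nodes_cong[of i x y] level_cong[of i x y] children_cong[of i x y] that by auto
  have D: "taut_determined k (?D k)" for k
  proof (rule taut_determinedI)
    fix x y :: "nat \<Rightarrow> nat"
    assume "\<And>l. 1 \<le> l \<Longrightarrow> l \<le> k \<Longrightarrow> x l = y l"
    then have "?W x i \<longleftrightarrow> ?W y i" if "i \<le> k" for i using that by (intro W_cong) auto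
    then show "(\<exists>i\<le>k. ?W x i) \<longleftrightarrow> (\<exists>i\<le>k. ?W y i)" by auto
  qed
  have "?A = (\<Union>k. ?D k)" by blast
  moreover have "(\<Union>k. ?D k) \<in> sets seed_space"
    using taut_determined_sets[OF D] by (intro sets.countable_UN) blast
  ultimately have A: "?A \<in> sets seed_space" by (simp only:)
  have bound: "\<exists>c>0. \<exists>C>0. \<exists>k0::nat. \<forall>k\<ge>1. k \<ge> k0 \<longrightarrow>
      measure (seed_law lam) (sym_diff ?A (?D k)) \<le> C * exp (- c * real k)"
    if lam: "0 < lam" for lam
  proof -
    interpret L: prob_space "seed_law lam" by (rule prob_space_seed_law)
    let ?F = "\<lambda>k. {x \<in> space seed_space. k \<in> nodes x \<and> (\<forall>i\<in>{1..k} \<inter> even_nodes x. x i \<noteq> 1)}"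
    obtain t where t: "0 < t" and F: "\<And>k. ?F k \<in> sets seed_space"
      "\<And>k. measure (seed_law lam) (?F k) \<le> exp (- t * real k)"
      using even_no_one_child_bound[OF lam] by blast
    have "measure (seed_law lam) (sym_diff ?A (?D k)) \<le> 1 * exp (- t * real k)" if "1 \<le> k" for k
    proof -
      \<comment> \<open>As \<open>?D k\<close> is contained in \<open>?A\<close>, an error means
        that all witnesses lie beyond \<open>k\<close>, which forces node \<open>k\<close> to
        exist.\<close>
      have "sym_diff ?A (?D k) \<subseteq> ?F k"
      proof
        fix x assume "x \<in> sym_diff ?A (?D k)"
        then have x: "x \<in> space seed_space" and no: "\<And>i. i \<le> k \<Longrightarrow> \<not> ?W x i"
          and ex: "\<exists>i. ?W x i" by auto
        then obtain i where "?W x i" by blast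
        with no[of i] have "i \<in> nodes x" "k \<le> i" by linarith+
        then have "k \<in> nodes x" by (intro nodes_downward[OF _ that])
        moreover have "x i \<noteq> 1" if "i \<in> {1..k} \<inter> even_nodes x" for i
          using no[of i] Q[of "level x i"] that by (auto simp: even_nodes_def card_children)
        ultimately show "x \<in> ?F k" using x by blast
      qed
      then have "measure (seed_law lam) (sym_diff ?A (?D k)) \<le> measure (seed_law lam) (?F k)"
        using F(1) by (intro L.finite_measure_mono) (auto simp: sets_seed_law)
      with F(2)[of k] show ?thesis by simp
    qed
    then show ?thesis using t by (intro exI[of _ t] conjI exI[of _ 1] exI[of _ 0]) auto
  qed
  show ?thesis
    unfolding rapidly_determined_def
    using A D bound by (intro conjI exI[of _ ?D]) auto
qed

theorem proposition1p7:
  shows "rapidly_determined A1 {0<..} \<and> rapidly_determined (A1 \<union> A2) {0<..}"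
proof
  show "rapidly_determined A1 {0<..}"
    unfolding A1_def by (rule rapidly_determined_ex_node[of "\<lambda>l n. even l \<and> n = 1"]) simp
  \<comment> \<open>Merging the two existential statements gives one \<open>Q\<close> that still
    accepts a single child on every even level.\<close>
  have "A1 \<union> A2 = {x \<in> space seed_space. \<exists>i\<in>nodes x.
      even (level x i) \<and> card (children x i) = 1 \<or> prime (level x i) \<and> card (children x i) = 2}"
    by (auto simp: A1_def A2_def)
  then show "rapidly_determined (A1 \<union> A2) {0<..}"
    using rapidly_determined_ex_node[of "\<lambda>l n. even l \<and> n = 1 \<or> prime l \<and> n = 2"] by simp
qed

end
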